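(* Let $f=h+\overline{g}$ be a univalent sense-preserving harmonic mapping of the unit disk $\mathbb{D}$. For $r\in[0,1)$ let $m(r)=\min_{|z|\le r}\big(|h'(z)|-|g'(z)|\big)$. Let $\varphi=p+\overline{q}$ be harmonic in $\mathbb{D}$ (with $p,q$ analytic in $\mathbb{D}$) such that $A=\sup_{z\in\mathbb{D}}\big(|p'(z)|+|q'(z)|\big)<\infty$. Then the function $F$ defined by $$F(z)=f(rz)+\varepsilon\varphi(z)$$ is univalent and sense-preserving in $\mathbb{D}$ for all $r\in(0,1)$ and for all $\varepsilon$ with $$0\le\varepsilon<\frac{r}{A}\min\{m(r),\,m(0)C(r)\},$$ where $$C(r)=\frac{1}{4\alpha r}\left(\frac{1-r}{1+r}\right)^{\alpha}\left[1-\left(\frac{1-r}{1+r}\right)^{2\alpha}\right],\qquad \alpha=\operatorname{ord}\mathcal{S}_H=\sup_{f=h+\overline{g}\in\mathcal{S}_H}|h''(0)/2|.$$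
   Context: $\mathbb{D}=\{z\in\mathbb{C}:|z|<1\}$; univalent means injective. A harmonic function on $\mathbb{D}$ is written $f=h+\overline{g}$ with $h,g$ analytic on $\mathbb{D}$; it is sense-preserving if its Jacobian $J_f(z)=|h'(z)|^2-|g'(z)|^2$ is positive on $\mathbb{D}$. $\mathcal{S}_H$ is the family of univalent sense-preserving harmonic functions $f=h+\overline{g}$ on $\mathbb{D}$ normalized by $h(0)=g(0)=0$ and $h'(0)=1$. If $A=0$ (i.e. $\varphi$ is constant), the upper bound on $\varepsilon$ is read as $+\infty$. *)

theory Defs
  imports "HOL-Complex_Analysis.Complex_Analysis"
begin

abbreviation unit_disk :: "complex set" where
  "unit_disk \<equiv> ball 0 1"

text \<open>Only the values of a function on the unit disk matter in all notions below.\<close>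

definition harmonic_rep ::
    "(complex \<Rightarrow> complex) \<Rightarrow> (complex \<Rightarrow> complex) \<Rightarrow> (complex \<Rightarrow> complex) \<Rightarrow> bool" where
  "harmonic_rep f h g \<longleftrightarrow>
     h holomorphic_on unit_disk \<and> g holomorphic_on unit_disk \<and>
     (\<forall>z\<in>unit_disk. f z = h z + cnj (g z))"

definition harmonic_jacobian ::
    "(complex \<Rightarrow> complex) \<Rightarrow> (complex \<Rightarrow> complex) \<Rightarrow> complex \<Rightarrow> real" where
  "harmonic_jacobian h g z = (cmod (deriv h z))\<^sup>2 - (cmod (deriv g z))\<^sup>2"

text \<open>The representation of a harmonic function is unique up to an additive constant in \<open>h\<close>
  and \<open>g\<close>, so the Jacobian does not depend on the representation chosen.\<close>

definition sense_preserving :: "(complex \<Rightarrow> complex) \<Rightarrow> bool" where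
  "sense_preserving f \<longleftrightarrow>
     (\<exists>h g. harmonic_rep f h g \<and> (\<forall>z\<in>unit_disk. harmonic_jacobian h g z > 0))"

definition univalent :: "(complex \<Rightarrow> complex) \<Rightarrow> bool" where
  "univalent f \<longleftrightarrow> inj_on f unit_disk"

text \<open>A member \<open>f = h + cnj g\<close> of the family is given by the pair \<open>(h, g)\<close>, which
  the normalization determines on the disk.\<close>

definition S_H :: "((complex \<Rightarrow> complex) \<times> (complex \<Rightarrow> complex)) set" where
  "S_H = {(h, g). h holomorphic_on unit_disk \<and> g holomorphic_on unit_disk \<and>
     univalent (\<lambda>z. h z + cnj (g z)) \<and> sense_preserving (\<lambda>z. h z + cnj (g z)) \<and>
     h 0 = 0 \<and> g 0 = 0 \<and> deriv h 0 = 1}"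

text \<open>The supremum is formed in the extended reals. It is finite by a classical theorem of
  Clunie and Sheil-Small, so the coercion to a real number loses nothing. (For an infinite
  supremum the coercion would give \<open>0\<close>, and \<open>C_bound\<close> below would then take the value \<open>0\<close>,
  which is also the limit of its defining formula as the order tends to infinity.)\<close>

definition ord_S_H :: real where
  "ord_S_H = real_of_ereal (SUP (h, g)\<in>S_H. ereal (cmod (deriv (deriv h) 0 / 2)))"

definition C_bound :: "real \<Rightarrow> real" where
  "C_bound r = 1 / (4 * ord_S_H * r) * ((1 - r) / (1 + r)) powr ord_S_H *
     (1 - ((1 - r) / (1 + r)) powr (2 * ord_S_H))"

text \<open>For \<open>0 \<le> r < 1\<close> the infimum is attained, because the function is continuous on the
  compact disk.\<close>

definition m_bound :: "(complex \<Rightarrow> complex) \<Rightarrow> (complex \<Rightarrow> complex) \<Rightarrow> real \<Rightarrow> real" where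
  "m_bound h g r = (INF z\<in>cball 0 r. cmod (deriv h z) - cmod (deriv g z))"

end

theory Submission
  imports Defs
begin

text \<open>On \<open>|z| \<le> r\<close> the mapping \<open>f\<close> separates points quantitatively:
  \<open>|f w - f z| \<ge> m(0) C(r) |w - z|\<close> (lemma \<open>univalent_pair_two_point_cball\<close>), and \<open>\<phi>\<close> has Lipschitz
  constant \<open>A\<close>. So \<open>\<epsilon> A < r m(0) C(r)\<close> forbids \<open>F w = F z\<close> for \<open>w \<noteq> z\<close>. Similarly \<open>\<epsilon> A < r m(r)\<close>
  keeps \<open>|h'| - |g'|\<close> of the sum positive.

  The separation bound is a consequence of linear and affine invariance. If \<open>\<alpha>\<close> bounds
  \<open>|h''(0)/2|\<close> on the normalized family, then composing \<open>f\<close> with the disk automorphism taking \<open>0\<close> to \<open>w\<close>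
  yields \<open>|(1 - |w|^2) h''(w)/2 - cnj w h'(w)| \<le> \<alpha> |h'(w)|\<close> at every point. Integrating this along
  rays, and using that \<open>f + c * cnj f\<close> belongs to the class for \<open>|c| < 1\<close>, gives
  \<open>(1 - |z|^2) (|h' z| - |g' z|) \<ge> (|h' 0| - |g' 0|) ((1 - |z|) / (1 + |z|))^\<alpha>\<close>
  (lemma \<open>min_stretch_lower_bound\<close>).

  Since \<open>|h'| - |g'|\<close> is the least stretching of \<open>f\<close>, a lower bound for it depending on \<open>|z|\<close> integrates to a lower
  bound for \<open>|f z - f 0|\<close>: pull back by \<open>f\<close> the segment from \<open>f 0\<close> to the nearest point of the image of the
  circle through \<open>z\<close> (lemma \<open>growth_of_min_stretch_bound\<close>). Applied to \<open>f\<close> composed with the automorphism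
  taking \<open>0\<close> to \<open>w\<close>, this bounds \<open>|f z - f w|\<close> below in terms of the pseudohyperbolic distance of
  \<open>w\<close> and \<open>z\<close>. That distance is at least \<open>2 s / (1 + s^2)\<close> with \<open>s = |w - z| / 2\<close>, and the resulting
  function of \<open>s\<close> is concave because \<open>2 \<alpha> \<ge> 1\<close>, so on \<open>[0, r]\<close> it dominates its
  chord. The slope of that chord is what appears in \<open>C(r)\<close>.\<close>

section \<open>Univalent harmonic mappings as pairs\<close>

definition univalent_pair :: "(complex \<Rightarrow> complex) \<Rightarrow> (complex \<Rightarrow> complex) \<Rightarrow> bool" where
  "univalent_pair h g \<longleftrightarrow> h holomorphic_on unit_disk \<and> g holomorphic_on unit_disk \<and>
     inj_on (\<lambda>z. h z + cnj (g z)) unit_disk \<and>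
     (\<forall>z\<in>unit_disk. cmod (deriv g z) < cmod (deriv h z))"

text \<open>The homogeneous form of \<open>|h''(0)/2| \<le> \<alpha>\<close> on the normalized family: the class of univalent pairs
  carries no normalization and so is closed under precomposition with disk automorphisms and
  under affine maps, which lets the bound be transported to every point of the disk.\<close>

definition second_coeff_bound :: "real \<Rightarrow> bool" where
  "second_coeff_bound \<alpha> \<longleftrightarrow>
     (\<forall>h g. univalent_pair h g \<longrightarrow> cmod (deriv (deriv h) 0 / 2) \<le> \<alpha> * cmod (deriv h 0))"

lemma holomorphic_disk_has_field_derivative:
  assumes "h holomorphic_on unit_disk" "z \<in> unit_disk"
  shows "(h has_field_derivative deriv h z) (at z)"
  using assms holomorphic_derivI by blast

lemma harmonic_has_derivative:
  assumes "h holomorphic_on unit_disk" "g holomorphic_on unit_disk" "z \<in> unit_disk"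
  shows "((\<lambda>z. h z + cnj (g z)) has_derivative (\<lambda>v. deriv h z * v + cnj (deriv g z * v))) (at z)"
proof -
  have 1: "(h has_derivative (\<lambda>v. deriv h z * v)) (at z)" "(g has_derivative (\<lambda>v. deriv g z * v)) (at z)"
    using holomorphic_disk_has_field_derivative[OF assms(1,3)] holomorphic_disk_has_field_derivative[OF assms(2,3)]
    by (simp_all add: has_field_derivative_def)
  show ?thesis
    by (intro has_derivative_add 1(1) has_derivative_cnj 1(2))
qed

text \<open>The real derivative \<open>v \<mapsto> h' v + cnj (g' v)\<close> determines both coefficients, because its
  complex linear part and its conjugate linear part can be read off at \<open>v = 1\<close> and \<open>v = \<i>\<close>. Hence
  the Jacobian is the same for all representations of a harmonic function.\<close>

lemma deriv_harmonic_unique: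
  assumes "h holomorphic_on unit_disk" "g holomorphic_on unit_disk"
    and "h' holomorphic_on unit_disk" "g' holomorphic_on unit_disk"
    and eq: "\<And>z. z \<in> unit_disk \<Longrightarrow> h z + cnj (g z) = h' z + cnj (g' z)"
    and z: "z \<in> unit_disk"
  shows "deriv h z = deriv h' z" "deriv g z = deriv g' z"
proof -
  have d: "((\<lambda>z. h z + cnj (g z)) has_derivative (\<lambda>v. deriv h' z * v + cnj (deriv g' z * v))) (at z)"
    using harmonic_has_derivative[OF assms(3,4) z]
    by (rule has_derivative_transform_within_open[of _ _ _ _ unit_disk]) (use z eq in auto)
  have "(\<lambda>v. deriv h z * v + cnj (deriv g z * v)) = (\<lambda>v. deriv h' z * v + cnj (deriv g' z * v))"
    using has_derivative_unique[OF harmonic_has_derivative[OF assms(1,2) z] d] .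
  hence eqv: "deriv h z * v + cnj (deriv g z * v) = deriv h' z * v + cnj (deriv g' z * v)" for v
    by metis
  have a: "deriv h z + cnj (deriv g z) = deriv h' z + cnj (deriv g' z)"
    using eqv[of 1] by simp
  have "\<i> * (deriv h z - cnj (deriv g z)) = \<i> * (deriv h' z - cnj (deriv g' z))"
    using eqv[of \<i>] by (simp add: algebra_simps)
  hence b: "deriv h z - cnj (deriv g z) = deriv h' z - cnj (deriv g' z)"
    by simp
  have "2 * deriv h z = 2 * deriv h' z"
    using arg_cong2[OF a b, of "(+)"] by simp
  thus "deriv h z = deriv h' z" by simp
  with a have "cnj (deriv g z) = cnj (deriv g' z)" by simp
  thus "deriv g z = deriv g' z" by simp
qed

lemma harmonic_jacobian_pos_iff:
  "harmonic_jacobian h g z > 0 \<longleftrightarrow> cmod (deriv g z) < cmod (deriv h z)"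
  unfolding harmonic_jacobian_def
  by (auto simp: power_mono_iff not_le[symmetric])

lemma univalent_pairI:
  assumes "harmonic_rep f h g" "univalent f" "sense_preserving f"
  shows "univalent_pair h g"
proof -
  from assms(3) obtain h' g' where hg: "harmonic_rep f h' g'"
      "\<And>z. z \<in> unit_disk \<Longrightarrow> cmod (deriv g' z) < cmod (deriv h' z)"
    unfolding sense_preserving_def harmonic_jacobian_pos_iff by blast
  have "deriv h z = deriv h' z \<and> deriv g z = deriv g' z" if "z \<in> unit_disk" for z
    using deriv_harmonic_unique[of h g h' g' z] that assms(1) hg(1)
    unfolding harmonic_rep_def by metis
  moreover have "inj_on (\<lambda>z. h z + cnj (g z)) unit_disk"
    using assms(1,2) unfolding univalent_def harmonic_rep_def inj_on_def by metis
  ultimately show ?thesis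
    using assms(1) hg(2) unfolding univalent_pair_def harmonic_rep_def by metis
qed

lemma univalent_pair_deriv_nonzero:
  assumes "univalent_pair h g" "z \<in> unit_disk"
  shows "deriv h z \<noteq> 0"
  using assms unfolding univalent_pair_def by force

section \<open>Affine and linear invariance\<close>

text \<open>This is \<open>f + c * cnj f\<close>, the composition of \<open>f\<close> with an injective real linear map
  of the plane that preserves orientation. It mixes \<open>g\<close> into the analytic part, and by the choice of
  \<open>c\<close> a bound on \<open>|h'|\<close> alone becomes a bound on \<open>|h'| - |g'|\<close>.\<close>

lemma univalent_pair_affine:
  assumes "univalent_pair h g" "cmod c < 1"
  shows "univalent_pair (\<lambda>z. h z + c * g z) (\<lambda>z. g z + cnj c * h z)"
proof -
  note hg = assms(1)[unfolded univalent_pair_def]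
  have inj: "a = b" if "a + c * cnj a = b + c * cnj b" for a b
  proof -
    have "a - b = - (c * cnj (a - b))"
      using that by (simp add: algebra_simps)
    hence "cmod (a - b) = cmod c * cmod (a - b)"
      by (metis norm_minus_cancel norm_mult complex_mod_cnj)
    thus ?thesis using assms(2) by simp
  qed
  have f_eq: "h z + c * g z + cnj (g z + cnj c * h z) = (h z + cnj (g z)) + c * cnj (h z + cnj (g z))" for z
    by (simp add: algebra_simps)
  have "inj_on (\<lambda>z. h z + c * g z + cnj (g z + cnj c * h z)) unit_disk"
    unfolding f_eq using hg inj unfolding inj_on_def by blast
  moreover have "cmod (deriv (\<lambda>z. g z + cnj c * h z) z) < cmod (deriv (\<lambda>z. h z + c * g z) z)"
    if z: "z \<in> unit_disk" for z
  proof -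
    note dh = holomorphic_disk_has_field_derivative[OF conjunct1[OF hg] z]
    note dg = holomorphic_disk_has_field_derivative[OF conjunct1[OF conjunct2[OF hg]] z]
    have 1: "deriv (\<lambda>z. g z + cnj c * h z) z = deriv g z + cnj c * deriv h z"
      by (intro DERIV_imp_deriv) (auto intro!: derivative_eq_intros dh dg)
    have 2: "deriv (\<lambda>z. h z + c * g z) z = deriv h z + c * deriv g z"
      by (intro DERIV_imp_deriv) (auto intro!: derivative_eq_intros dh dg)
    \<comment> \<open>The Jacobian is multiplied by \<open>1 - |c|^2\<close>, the determinant of \<open>w \<mapsto> w + c * cnj w\<close>.\<close>
    have id: "(cmod (a + c * b))\<^sup>2 - (cmod (b + cnj c * a))\<^sup>2 = (1 - (cmod c)\<^sup>2) * ((cmod a)\<^sup>2 - (cmod b)\<^sup>2)" for a b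
    proof -
      have "complex_of_real ((cmod (a + c * b))\<^sup>2 - (cmod (b + cnj c * a))\<^sup>2)
        = complex_of_real ((1 - (cmod c)\<^sup>2) * ((cmod a)\<^sup>2 - (cmod b)\<^sup>2))"
        unfolding of_real_diff of_real_mult of_real_1 complex_norm_square
        by (simp add: algebra_simps)
      thus ?thesis by (simp only: of_real_eq_iff)
    qed
    have "0 < (1 - (cmod c)\<^sup>2) * ((cmod (deriv h z))\<^sup>2 - (cmod (deriv g z))\<^sup>2)"
      using assms(2) hg z by (intro mult_pos_pos) (auto simp: abs_square_less_1 intro: power_strict_mono)
    hence "(cmod (deriv g z + cnj c * deriv h z))\<^sup>2 < (cmod (deriv h z + c * deriv g z))\<^sup>2"
      using id[of "deriv h z" "deriv g z"] by linarith
    thus ?thesis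
      unfolding 1 2 by (rule power_less_imp_less_base) simp
  qed
  ultimately show ?thesis
    using hg unfolding univalent_pair_def by (auto intro!: holomorphic_intros)
qed

lemma Moebius_denominator_nonzero:
  fixes w z :: complex
  assumes "w \<in> unit_disk" "z \<in> unit_disk"
  shows "1 + cnj w * z \<noteq> 0"
proof
  assume "1 + cnj w * z = 0"
  hence "cmod (cnj w * z) = 1"
    by (metis add_eq_0_iff norm_minus_cancel norm_one)
  moreover have "cmod (cnj w * z) < 1"
    using assms norm_mult_less[of "cnj w" 1 z 1] by simp
  ultimately show False by simp
qed

lemma Moebius_has_field_derivative:
  assumes "w \<in> unit_disk" "z \<in> unit_disk"
  shows "(Moebius_function 0 (-w) has_field_derivative (1 - (cmod w)\<^sup>2) / (1 + cnj w * z)\<^sup>2) (at z)"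
proof -
  have "((\<lambda>z. (z + w) / (1 + cnj w * z)) has_field_derivative (1 - (cmod w)\<^sup>2) / (1 + cnj w * z)\<^sup>2) (at z)"
    using Moebius_denominator_nonzero[OF assms] unfolding of_real_power[symmetric] complex_norm_square of_real_diff
    by (auto intro!: derivative_eq_intros simp: complex_norm_square power2_eq_square field_simps)
  thus ?thesis by (simp add: Moebius_function_simple[abs_def])
qed

lemma Moebius_in_disk:
  assumes "w \<in> unit_disk" "z \<in> unit_disk"
  shows "Moebius_function 0 (-w) z \<in> unit_disk"
  using Moebius_function_norm_lt_1[of "-w" z 0] assms by simp

lemma deriv_comp_Moebius:
  assumes "h holomorphic_on unit_disk" "w \<in> unit_disk" "z \<in> unit_disk"
  shows "deriv (\<lambda>z. h (Moebius_function 0 (-w) z)) z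
    = deriv h (Moebius_function 0 (-w) z) * ((1 - (cmod w)\<^sup>2) / (1 + cnj w * z)\<^sup>2)"
  using DERIV_chain'[OF Moebius_has_field_derivative[OF assms(2,3)]
      holomorphic_disk_has_field_derivative[OF assms(1) Moebius_in_disk[OF assms(2,3)]]]
  by (intro DERIV_imp_deriv) (simp add: mult_ac)

lemma univalent_pair_Moebius:
  assumes "univalent_pair h g" and w: "w \<in> unit_disk"
  shows "univalent_pair (\<lambda>z. h (Moebius_function 0 (-w) z)) (\<lambda>z. g (Moebius_function 0 (-w) z))"
proof -
  note hg = assms(1)[unfolded univalent_pair_def]
  have w': "cmod w < 1" using w by simp
  have hol: "(\<lambda>z. k (Moebius_function 0 (-w) z)) holomorphic_on unit_disk" if "k holomorphic_on unit_disk" for k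
  proof -
    have "Moebius_function 0 (-w) ` unit_disk \<subseteq> unit_disk"
      using Moebius_in_disk[OF w] by blast
    with holomorphic_on_compose_gen[OF Moebius_function_holomorphic[of "-w" 0] that] w'
    show ?thesis by (simp add: o_def)
  qed
  have "inj_on (Moebius_function 0 (-w)) unit_disk"
    by (rule inj_on_inverseI[where g = "Moebius_function 0 w"])
       (use w' in \<open>auto intro!: Moebius_function_compose\<close>)
  hence inj: "inj_on ((\<lambda>z. h z + cnj (g z)) \<circ> Moebius_function 0 (-w)) unit_disk"
    using Moebius_in_disk[OF w] hg by (intro comp_inj_on) (auto intro: inj_on_subset)
  have "cmod (deriv (\<lambda>z. g (Moebius_function 0 (-w) z)) z) < cmod (deriv (\<lambda>z. h (Moebius_function 0 (-w) z)) z)"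
    if z: "z \<in> unit_disk" for z
  proof -
    have "((1 - (cmod w)\<^sup>2) / (1 + cnj w * z)\<^sup>2) \<noteq> 0"
    proof -
      have "(cmod w)\<^sup>2 < 1" using w' by (simp add: abs_square_less_1)
      hence "1 - (cmod w)\<^sup>2 \<noteq> 0" by simp
      hence "complex_of_real (1 - (cmod w)\<^sup>2) \<noteq> 0" by (simp only: of_real_eq_0_iff not_False_eq_True)
      thus ?thesis using Moebius_denominator_nonzero[OF w z] by simp
    qed
    thus ?thesis
      using hg Moebius_in_disk[OF w z] deriv_comp_Moebius[OF _ w z]
      by (simp only: norm_mult deriv_comp_Moebius[OF _ w z]) (simp only: mult_less_cancel_right zero_less_norm_iff, simp)
  qed
  thus ?thesis
    using hg inj hol unfolding univalent_pair_def by (auto simp: o_def)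
qed

text \<open>The second Taylor coefficient at \<open>0\<close> of \<open>h\<close> composed with the automorphism that sends
  \<open>0\<close> to \<open>w\<close> is \<open>1 - |w|^2\<close> times the expression inside the modulus. So the bound at the origin becomes a
  differential inequality for \<open>h'\<close>.\<close>

lemma second_coeff_bound_pointwise:
  fixes w :: complex
  assumes "second_coeff_bound \<alpha>" "univalent_pair h g" and w: "w \<in> unit_disk"
  shows "cmod (of_real ((1 - (cmod w)\<^sup>2) / 2) * deriv (deriv h) w - cnj w * deriv h w) \<le> \<alpha> * cmod (deriv h w)"
proof -
  define M where "M = Moebius_function 0 (-w)"
  define d where "d = 1 - (cmod w)\<^sup>2"
  have w': "cmod w < 1" using w by simp
  have d: "d > 0" using w' by (simp add: d_def abs_square_less_1)
  have h: "h holomorphic_on unit_disk" using assms(2) by (simp add: univalent_pair_def)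
  have h': "deriv h holomorphic_on unit_disk" using h by (auto intro: holomorphic_deriv)
  have M0: "M 0 = w" by (simp add: M_def Moebius_function_of_zero)
  have dM: "(M has_field_derivative d) (at 0)"
    using Moebius_has_field_derivative[OF w, of 0] by (simp add: M_def d_def)
  have d1: "deriv (\<lambda>z. h (M z)) 0 = deriv h w * d"
    using deriv_comp_Moebius[OF h w, of 0] by (simp add: M_def[symmetric] M0 d_def)
  have dh': "(deriv h has_field_derivative deriv (deriv h) w) (at (M 0))"
    using holomorphic_disk_has_field_derivative[OF h' w] by (simp add: M0)
  have "((\<lambda>z. deriv h (M z) * (d / (1 + cnj w * z)\<^sup>2)) has_field_derivative
      (deriv (deriv h) w * d\<^sup>2 - 2 * cnj w * deriv h w * d)) (at 0)"
    by (rule derivative_eq_intros DERIV_chain'[OF dM dh'] refl | simp add: M0)+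
       (simp add: power2_eq_square algebra_simps)
  hence "(deriv (\<lambda>z. h (M z)) has_field_derivative
      (deriv (deriv h) w * d\<^sup>2 - 2 * cnj w * deriv h w * d)) (at 0)"
    by (rule has_field_derivative_transform_within_open[of _ _ _ unit_disk])
       (use deriv_comp_Moebius[OF h w] in \<open>auto simp: M_def d_def\<close>)
  hence d2: "deriv (deriv (\<lambda>z. h (M z))) 0 = deriv (deriv h) w * d\<^sup>2 - 2 * cnj w * deriv h w * d"
    by (rule DERIV_imp_deriv)
  have "cmod (deriv (deriv (\<lambda>z. h (M z))) 0 / 2) \<le> \<alpha> * cmod (deriv (\<lambda>z. h (M z)) 0)"
    using assms(1) univalent_pair_Moebius[OF assms(2) w] unfolding second_coeff_bound_def M_def by blast
  also have "deriv (deriv (\<lambda>z. h (M z))) 0 / 2 = d * (d / 2 * deriv (deriv h) w - cnj w * deriv h w)"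
    unfolding d2 by (simp add: power2_eq_square algebra_simps diff_divide_distrib)
  finally have "d * cmod (d / 2 * deriv (deriv h) w - cnj w * deriv h w) \<le> d * (\<alpha> * cmod (deriv h w))"
    unfolding d1 using d by (simp add: norm_mult mult_ac)
  thus ?thesis using d by (simp add: d_def)
qed


section \<open>Distortion\<close>

text \<open>On the ray from \<open>0\<close> through \<open>z\<close>, the pointwise coefficient bound says that
  \<open>ln |h'(t e)| + ln (1 - t^2) + \<alpha> (ln (1 + t) - ln (1 - t))\<close> has a nonnegative derivative in \<open>t\<close>;
  compare its values at \<open>0\<close> and \<open>|z|\<close>.\<close>

lemma deriv_lower_bound:
  assumes coeff: "second_coeff_bound \<alpha>" and hg: "univalent_pair h g" and z: "z \<in> unit_disk"
  shows "cmod (deriv h 0) * ((1 - cmod z) / (1 + cmod z)) powr \<alpha> \<le> (1 - (cmod z)\<^sup>2) * cmod (deriv h z)"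
proof (cases "z = 0")
  case True
  then show ?thesis by simp
next
  case False
  define e where "e = z / cmod z"
  have e: "cmod e = 1" using False by (simp add: e_def norm_divide)
  have ze: "z = of_real (cmod z) * e" using False by (simp add: e_def)
  have z1: "cmod z < 1" using z by simp
  have h: "h holomorphic_on unit_disk" using hg by (simp add: univalent_pair_def)
  have h': "deriv h holomorphic_on unit_disk" using h by (auto intro: holomorphic_deriv)
  define L where "L t = ln (cmod (deriv h (of_real t * e))) + ln (1 - t\<^sup>2) + \<alpha> * (ln (1 + t) - ln (1 - t))" for t :: real
  have "L 0 \<le> L (cmod z)"
  proof (rule DERIV_nonneg_imp_nondecreasing[where f = L])
    fix t :: real assume t: "0 \<le> t" "t \<le> cmod z"
    define w where "w = of_real t * e"
    define k where "k = deriv h w"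
    define k2 where "k2 = deriv (deriv h) w"
    have t1: "t < 1" and cw: "cmod w = t" and w: "w \<in> unit_disk"
      using t z1 e by (auto simp: w_def norm_mult)
    have tt: "1 - t\<^sup>2 > 0" using t1 t(1) by (simp add: abs_square_less_1)
    have k: "k \<noteq> 0" using univalent_pair_deriv_nonzero[OF hg w] by (simp add: k_def)
    define x where "x = Re (e * k2 * cnj k)"
    have "((\<lambda>t. of_real t * e) has_vector_derivative e) (at t)"
      by (auto intro!: derivative_eq_intros simp: has_vector_derivative_def scaleR_conv_of_real)
    hence "((deriv h \<circ> (\<lambda>t. of_real t * e)) has_vector_derivative (e * k2)) (at t)"
      using holomorphic_disk_has_field_derivative[OF h' w] unfolding w_def k2_def
      by (intro field_vector_diff_chain_at)
    hence du: "((\<lambda>t. deriv h (of_real t * e)) has_derivative (\<lambda>s. s *\<^sub>R (e * k2))) (at t)"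
      by (simp add: o_def has_vector_derivative_def)
    have sq: "cmod k * cmod k = k \<bullet> k" by (simp add: power2_norm_eq_inner[symmetric] power2_eq_square)
    have dnorm: "((\<lambda>t. cmod (deriv h (of_real t * e))) has_field_derivative x / cmod k) (at t)"
    proof -
      have "((\<lambda>t. cmod (deriv h (of_real t * e))) has_derivative (\<lambda>s. (s *\<^sub>R (e * k2)) \<bullet> sgn (deriv h (of_real t * e)))) (at t)"
        using has_derivative_compose[OF du has_derivative_norm] k by (simp add: k_def w_def)
      moreover
      have "(s *\<^sub>R (e * k2)) \<bullet> sgn (deriv h (of_real t * e)) = (x / cmod k) * s" for s
      proof -
        have "deriv h (of_real t * e) = k" by (simp add: k_def w_def)
        thus ?thesis by (simp add: sgn_div_norm x_def inner_complex_def divide_inverse algebra_simps)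
      qed
      hence "(\<lambda>s. (s *\<^sub>R (e * k2)) \<bullet> sgn (deriv h (of_real t * e))) = (*) (x / cmod k)"
        by (rule ext)
      ultimately show ?thesis unfolding has_field_derivative_def by argo
    qed
    define D where "D = x / (cmod k)\<^sup>2 + (- (2 * t)) / (1 - t\<^sup>2) + \<alpha> * (1 / (1 + t) + 1 / (1 - t))"
    have kn: "cmod (deriv h (of_real t * e)) > 0" using k by (simp add: k_def w_def)
    have dL: "(L has_field_derivative D) (at t)"
    proof -
      have "((\<lambda>t. ln (cmod (deriv h (of_real t * e)))) has_field_derivative x / (cmod k)\<^sup>2) (at t)"
        using DERIV_chain2[OF DERIV_ln_divide[OF kn] dnorm] by (simp add: power2_eq_square k_def w_def)
      moreover have "((\<lambda>t::real. ln (1 - t\<^sup>2)) has_field_derivative (- (2 * t)) / (1 - t\<^sup>2)) (at t)"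
        using tt by (auto intro!: derivative_eq_intros simp: field_simps)
      moreover have "((\<lambda>t::real. \<alpha> * (ln (1 + t) - ln (1 - t))) has_field_derivative \<alpha> * (1 / (1 + t) + 1 / (1 - t))) (at t)"
        using t t1 by (auto intro!: derivative_eq_intros simp: field_simps)
      ultimately show ?thesis
        unfolding L_def[abs_def] D_def by (intro DERIV_add)
    qed
    have "D \<ge> 0"
    proof -
      define v where "v = of_real ((1 - t\<^sup>2) / 2) * k2 - cnj w * k"
      \<comment> \<open>Multiplying by \<open>e * cnj k\<close> turns the differential inequality into one for the radial
        derivative \<open>x / |k|^2\<close> of \<open>ln |h'|\<close>.\<close>
      have "cmod v \<le> \<alpha> * cmod k"
        using second_coeff_bound_pointwise[OF coeff hg w] by (simp add: v_def k_def k2_def cw)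
      hence "cmod (e * v * cnj k) \<le> \<alpha> * cmod k * cmod k"
        using e by (simp add: norm_mult mult_right_mono)
      hence "- (\<alpha> * cmod k * cmod k) \<le> Re (e * v * cnj k)"
        using abs_Re_le_cmod[of "e * v * cnj k"] by linarith
      also have "e * v * cnj k = of_real ((1 - t\<^sup>2) / 2) * (e * k2 * cnj k) - of_real t * (e * cnj e) * (k * cnj k)"
        by (simp add: v_def w_def algebra_simps)
      also have "Re \<dots> = (1 - t\<^sup>2) / 2 * x - t * (cmod k)\<^sup>2"
        using e by (simp only: complex_norm_square[symmetric] x_def) simp
      finally have "- (\<alpha> * cmod k * cmod k) \<le> (1 - t\<^sup>2) / 2 * x - t * (cmod k)\<^sup>2" .
      hence "0 \<le> 2 / ((1 - t\<^sup>2) * (cmod k)\<^sup>2) * ((1 - t\<^sup>2) / 2 * x - t * (cmod k)\<^sup>2 + \<alpha> * (cmod k)\<^sup>2)"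
        using tt by (intro mult_nonneg_nonneg) (auto simp: power2_eq_square)
      also have "\<dots> = D"
      proof -
        have "\<alpha> * (1 / (1 + t) + 1 / (1 - t)) = 2 * \<alpha> / (1 - t\<^sup>2)"
          using t t1 tt by (simp add: field_simps power2_eq_square)
        hence "D = x / (cmod k)\<^sup>2 - 2 * t / (1 - t\<^sup>2) + 2 * \<alpha> / (1 - t\<^sup>2)"
          unfolding D_def by simp
        moreover have "2 / (d * K) * (d / 2 * x - t * K + \<alpha> * K) = x / K - 2 * t / d + 2 * \<alpha> / d"
          if "d > 0" "K > 0" for d K :: real
          using that by (simp add: field_simps)
        ultimately show ?thesis
          using tt k by simp
      qed
      finally show ?thesis .
    qed
    with dL show "\<exists>y. DERIV L t :> y \<and> y \<ge> 0" by blast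
  qed simp
  hence 1: "ln (cmod (deriv h 0)) \<le> ln (cmod (deriv h z)) + ln (1 - (cmod z)\<^sup>2) + \<alpha> * (ln (1 + cmod z) - ln (1 - cmod z))"
    unfolding L_def using ze by simp
  have pos: "cmod (deriv h 0) > 0" "cmod (deriv h z) > 0" "1 - (cmod z)\<^sup>2 > 0" "1 - cmod z > 0" "1 + cmod z > 0"
  proof -
    show "cmod (deriv h 0) > 0" "cmod (deriv h z) > 0"
      using univalent_pair_deriv_nonzero[OF hg] z by auto
    show "1 - (cmod z)\<^sup>2 > 0" "1 - cmod z > 0" "1 + cmod z > 0"
      using z1 by (auto simp: abs_square_less_1 add_pos_nonneg)
  qed
  have "cmod (deriv h 0) = exp (ln (cmod (deriv h 0)))" using pos by simp
  also have "\<dots> \<le> exp (ln (cmod (deriv h z)) + ln (1 - (cmod z)\<^sup>2) + \<alpha> * (ln (1 + cmod z) - ln (1 - cmod z)))"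
    using 1 by simp
  also have "\<dots> = (1 - (cmod z)\<^sup>2) * cmod (deriv h z) * exp (\<alpha> * (ln (1 + cmod z) - ln (1 - cmod z)))"
    using pos by (simp add: exp_add)
  finally have "cmod (deriv h 0) * ((1 - cmod z) / (1 + cmod z)) powr \<alpha> \<le>
     (1 - (cmod z)\<^sup>2) * cmod (deriv h z) * exp (\<alpha> * (ln (1 + cmod z) - ln (1 - cmod z)))
      * ((1 - cmod z) / (1 + cmod z)) powr \<alpha>"
    by (intro mult_right_mono) auto
  moreover have "((1 - cmod z) / (1 + cmod z)) powr \<alpha> = exp (- (\<alpha> * (ln (1 + cmod z) - ln (1 - cmod z))))"
    using pos by (simp add: powr_def ln_div algebra_simps)
  ultimately show ?thesis
    by (simp add: mult.assoc flip: exp_add)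
qed

text \<open>The bound on the derivative of the analytic part, applied to \<open>f + c * cnj f\<close>. The argument of \<open>c\<close> is chosen
  so that \<open>h'(z)\<close> and \<open>c g'(z)\<close> point in opposite directions, and then \<open>|c|\<close> tends to \<open>1\<close>.\<close>

lemma min_stretch_lower_bound:
  assumes coeff: "second_coeff_bound \<alpha>" and hg: "univalent_pair h g" and z: "z \<in> unit_disk"
  shows "(cmod (deriv h 0) - cmod (deriv g 0)) * ((1 - cmod z) / (1 + cmod z)) powr \<alpha>
    \<le> (1 - (cmod z)\<^sup>2) * (cmod (deriv h z) - cmod (deriv g z))"
    (is "?b * ?P \<le> ?d * _")
proof -
  define a where "a = deriv h z"
  define b where "b = deriv g z"
  have a: "a \<noteq> 0" using univalent_pair_deriv_nonzero[OF hg z] by (simp add: a_def)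
  have h: "h holomorphic_on unit_disk" and g: "g holomorphic_on unit_disk"
    using hg by (auto simp: univalent_pair_def)
  obtain u where u: "cmod u = 1" "u * b = - (cmod b / cmod a) * a"
  proof (cases "b = 0")
    case False
    show ?thesis
      by (rule that[of "- (cmod b / cmod a) * a / b"]) (use False a in \<open>auto simp: norm_mult norm_divide\<close>)
  qed (auto intro: that[of 1])
  have 1: "?b * ?P \<le> ?d * (cmod a - s * cmod b)" if s: "0 < s" "s < 1" for s
  proof -
    define c where "c = of_real s * u"
    have c: "cmod c = s" using s u by (simp add: c_def norm_mult)
    have dc: "deriv (\<lambda>z. h z + c * g z) z = deriv h z + c * deriv g z" if "z \<in> unit_disk" for z
      using holomorphic_disk_has_field_derivative[OF h that] holomorphic_disk_has_field_derivative[OF g that]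
      by (intro DERIV_imp_deriv) (auto intro!: derivative_eq_intros)
    have pair: "univalent_pair (\<lambda>z. h z + c * g z) (\<lambda>z. g z + cnj c * h z)"
      using univalent_pair_affine[OF hg, of c] c s by simp
    have "?b \<le> cmod (deriv h 0) - s * cmod (deriv g 0)"
      using s by (simp add: mult_left_le_one_le)
    also have "\<dots> \<le> cmod (deriv h 0 + c * deriv g 0)"
      using norm_diff_ineq[of "deriv h 0" "c * deriv g 0"] c by (simp add: norm_mult)
    finally have "?b * ?P \<le> cmod (deriv h 0 + c * deriv g 0) * ?P"
      by (intro mult_right_mono) auto
    also have "\<dots> \<le> ?d * cmod (a + c * b)"
      using deriv_lower_bound[OF coeff pair z] z by (simp add: dc a_def b_def)
    also have "a + c * b = of_real (1 - s * (cmod b / cmod a)) * a"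
    proof -
      have "c * b = of_real s * (- (cmod b / cmod a) * a)"
        using u(2) by (simp only: c_def mult.assoc)
      thus ?thesis by (simp add: algebra_simps)
    qed
    also have "cmod \<dots> = (1 - s * (cmod b / cmod a)) * cmod a"
    proof -
      have "cmod b < cmod a" using hg z unfolding univalent_pair_def a_def b_def by blast
      hence "s * (cmod b / cmod a) \<le> 1"
        using s a by (intro mult_le_one) auto
      thus ?thesis by (simp only: norm_mult norm_of_real)
    qed
    also have "\<dots> = cmod a - s * cmod b" using a by (simp add: field_simps)
    finally show ?thesis .
  qed
  have "((\<lambda>s. ?d * (cmod a - s * cmod b)) \<longlongrightarrow> ?d * (cmod a - 1 * cmod b)) (at_left 1)"
    by (intro tendsto_intros)
  moreover have "eventually (\<lambda>s. ?b * ?P \<le> ?d * (cmod a - s * cmod b)) (at_left (1::real))"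
    unfolding eventually_at_left[OF zero_less_one] using 1 zero_less_one by blast
  ultimately have "?b * ?P \<le> ?d * (cmod a - 1 * cmod b)"
    by (rule tendsto_lowerbound) simp
  thus ?thesis by (simp add: a_def b_def)
qed

section \<open>Growth\<close>

lemma min_stretch_mult_le_norm: "(cmod a - cmod b) * cmod v \<le> cmod (a * v + cnj (b * v))"
  using norm_diff_ineq[of "a * v" "cnj (b * v)"] by (simp add: norm_mult algebra_simps)

lemma inverse_real_linear_map:
  assumes "cmod b < cmod a"
  defines "J \<equiv> of_real ((cmod a)\<^sup>2 - (cmod b)\<^sup>2)"
  shows "(\<lambda>v. a * v + cnj (b * v)) \<circ> (\<lambda>y. (cnj a * y - cnj b * cnj y) / J) = id"
proof
  fix y
  have "(cmod b)\<^sup>2 < (cmod a)\<^sup>2" using assms(1) by (simp add: power_strict_mono)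
  hence J: "J \<noteq> 0" unfolding J_def by (simp only: of_real_eq_0_iff)
  have J': "cnj J = J" by (simp add: J_def)
  have JJ: "J = a * cnj a - b * cnj b" by (simp only: J_def complex_norm_square of_real_diff)
  have "a * ((cnj a * y - cnj b * cnj y) / J) + cnj (b * ((cnj a * y - cnj b * cnj y) / J))
     = (a * (cnj a * y - cnj b * cnj y) + cnj b * (a * cnj y - b * y)) / J"
    using J by (simp add: J' add_divide_distrib)
  also have "\<dots> = (J * y) / J" by (simp add: JJ algebra_simps)
  finally show "((\<lambda>v. a * v + cnj (b * v)) \<circ> (\<lambda>y. (cnj a * y - cnj b * cnj y) / J)) y = id y"
    using J by simp
qed

text \<open>It suffices to treat a point \<open>z0\<close> where \<open>|f - f 0|\<close> is minimal on the circle through \<open>z\<close>. The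
  image of the open disk inside that circle is open, and its frontier lies in the image of the circle, so by
  minimality it contains the segment from \<open>f 0\<close> to \<open>f z0\<close> up to the endpoint. Pull the segment back by
  \<open>f\<close> to a curve \<open>\<zeta>\<close>
  from \<open>0\<close> to \<open>z0\<close>. Along it \<open>f\<close> stretches by at least \<open>|h'| - |g'| \<ge> G' |\<zeta>|\<close>, hence
  \<open>G |\<zeta>|\<close> grows no faster than the arc length of the segment.\<close>

lemma growth_of_min_stretch_bound:
  fixes G G' :: "real \<Rightarrow> real"
  assumes hg: "univalent_pair h g" and z: "z \<in> unit_disk"
    and f_def: "\<And>z. f z = h z + cnj (g z)"
    and dG: "\<And>t. 0 \<le> t \<Longrightarrow> t < 1 \<Longrightarrow> (G has_field_derivative G' t) (at t)"
    and G'_nonneg: "\<And>t. 0 \<le> t \<Longrightarrow> t < 1 \<Longrightarrow> G' t \<ge> 0"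
    and bound: "\<And>w. w \<in> unit_disk \<Longrightarrow> G' (cmod w) \<le> cmod (deriv h w) - cmod (deriv g w)"
  shows "G (cmod z) - G 0 \<le> cmod (f z - f 0)"
proof (cases "z = 0")
  case False
  define \<rho> where "\<rho> = cmod z"
  have \<rho>: "0 < \<rho>" "\<rho> < 1" using False z by (auto simp: \<rho>_def)
  have sub: "cball (0::complex) \<rho> \<subseteq> unit_disk" using \<rho> by auto
  have inj: "inj_on f unit_disk" using hg by (simp add: univalent_pair_def f_def[abs_def])
  have df: "(f has_derivative (\<lambda>v. deriv h w * v + cnj (deriv g w * v))) (at w)" if "w \<in> unit_disk" for w
    using harmonic_has_derivative[of h g w] hg that by (simp add: univalent_pair_def f_def[abs_def])
  have cont: "continuous_on unit_disk f"
    using df by (meson continuous_at_imp_continuous_on has_derivative_continuous)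
  have "continuous_on (sphere 0 \<rho>) (\<lambda>z. cmod (f z - f 0))"
    by (intro continuous_intros continuous_on_subset[OF cont]) (use \<rho> in auto)
  moreover have "sphere (0::complex) \<rho> \<noteq> {}" using \<rho> by simp
  ultimately obtain z0 where z0: "cmod z0 = \<rho>"
      and min: "\<And>w. cmod w = \<rho> \<Longrightarrow> cmod (f z0 - f 0) \<le> cmod (f w - f 0)"
    using continuous_attains_inf[OF compact_sphere, of "0::complex" \<rho> "\<lambda>z. cmod (f z - f 0)"] by auto
  define e where "e = f z0 - f 0"
  have z0d: "z0 \<in> unit_disk" using z0 \<rho> by simp
  have e: "e \<noteq> 0"
    using inj_onD[OF inj, of z0 0] z0d z0 \<rho> by (auto simp: e_def)
  have open_img: "open (f ` ball 0 \<rho>)"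
  proof (rule invariance_of_domain)
    have "ball (0::complex) \<rho> \<subseteq> unit_disk" using sub ball_subset_cball by blast
    thus "continuous_on (ball 0 \<rho>) f" "inj_on f (ball 0 \<rho>)"
      using continuous_on_subset[OF cont] inj_on_subset[OF inj] by blast+
  qed simp
  have compact_img: "compact (f ` cball 0 \<rho>)"
    by (intro compact_continuous_image continuous_on_subset[OF cont] sub compact_cball)
  have frontier: "frontier (f ` ball 0 \<rho>) \<subseteq> f ` sphere 0 \<rho>"
  proof -
    have "closure (f ` ball 0 \<rho>) \<subseteq> f ` cball 0 \<rho>"
      using compact_img by (intro closure_minimal compact_imp_closed) auto
    thus ?thesis
      unfolding frontier_def interior_open[OF open_img] by force
  qed
  have segment: "f 0 + of_real t * e \<in> f ` ball 0 \<rho>" if t: "0 \<le> t" "t < 1" for t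
  proof (rule ccontr)
    assume *: "f 0 + of_real t * e \<notin> f ` ball 0 \<rho>"
    define S where "S = (\<lambda>s. f 0 + of_real s * e) ` {0..t}"
    have "connected S" unfolding S_def
      by (intro connected_continuous_image continuous_intros connected_Icc)
    moreover have "S \<inter> f ` ball 0 \<rho> \<noteq> {}"
    proof -
      have "f 0 \<in> S" unfolding S_def by (rule image_eqI[of _ _ 0]) (use t in auto)
      thus ?thesis using \<rho> by auto
    qed
    moreover have "S - f ` ball 0 \<rho> \<noteq> {}"
      using * t unfolding S_def by (metis DiffI atLeastAtMost_iff empty_iff image_eqI order_refl)
    ultimately have "S \<inter> frontier (f ` ball 0 \<rho>) \<noteq> {}"
      by (rule connected_Int_frontier)
    then obtain s w where s: "0 \<le> s" "s \<le> t" "cmod w = \<rho>" "f 0 + of_real s * e = f w"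
      using frontier by (fastforce simp: S_def)
    hence "cmod (f w - f 0) = s * cmod e"
      by (metis abs_of_nonneg add_diff_cancel_left' norm_mult norm_of_real)
    also have "\<dots> < cmod e" using s t e by simp
    finally show False using min[OF s(3)] by (simp add: e_def)
  qed
  define inv where "inv = inv_into unit_disk f"
  define \<zeta> where "\<zeta> t = inv (f 0 + of_real t * e)" for t :: real
  have inv_f: "inv (f w) = w" if "w \<in> unit_disk" for w
    using inj that by (simp add: inv_def)
  have \<zeta>_lt: "cmod (\<zeta> t) < \<rho>" and f_\<zeta>: "f (\<zeta> t) = f 0 + of_real t * e" if t: "0 \<le> t" "t < 1" for t
  proof -
    obtain w where w: "w \<in> ball 0 \<rho>" "f 0 + of_real t * e = f w" using segment[OF t] by blast
    hence "\<zeta> t = w" using inv_f[of w] \<rho> by (simp add: \<zeta>_def)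
    thus "cmod (\<zeta> t) < \<rho>" "f (\<zeta> t) = f 0 + of_real t * e" using w by auto
  qed
  have \<zeta>0: "\<zeta> 0 = 0" using inv_f[of 0] by (simp add: \<zeta>_def)
  have \<zeta>1: "\<zeta> 1 = z0" using inv_f[OF z0d] by (simp add: \<zeta>_def e_def)
  have f\<zeta>': "f (\<zeta> t) = f 0 + of_real t * e" and \<zeta>_disk: "\<zeta> t \<in> unit_disk" if "t \<in> {0..1}" for t
  proof -
    have "f (\<zeta> t) = f 0 + of_real t * e \<and> \<zeta> t \<in> unit_disk"
    proof (cases "t = 1")
      case True thus ?thesis using \<zeta>1 z0d by (simp add: e_def)
    next
      case False thus ?thesis using f_\<zeta>[of t] \<zeta>_lt[of t] that \<rho> by force
    qed
    thus "f (\<zeta> t) = f 0 + of_real t * e" "\<zeta> t \<in> unit_disk" by blast+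
  qed
  have d\<zeta>: "\<exists>v. (\<zeta> has_vector_derivative v) (at t) \<and> deriv h (\<zeta> t) * v + cnj (deriv g (\<zeta> t) * v) = e"
    if t: "t \<in> {0..1}" for t
  proof -
    define a where "a = deriv h (\<zeta> t)"
    define b where "b = deriv g (\<zeta> t)"
    define J where "J = complex_of_real ((cmod a)\<^sup>2 - (cmod b)\<^sup>2)"
    define I where "I = (\<lambda>y. (cnj a * y - cnj b * cnj y) / J)"
    have ab: "cmod b < cmod a" using hg \<zeta>_disk[OF t] by (simp add: univalent_pair_def a_def b_def)
    have comp: "(\<lambda>v. a * v + cnj (b * v)) \<circ> I = id"
      unfolding I_def J_def by (rule inverse_real_linear_map[OF ab])
    \<comment> \<open>\<open>I\<close> inverts the derivative of \<open>f\<close>, so it is the derivative of the inverse function.\<close>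
    have dinv: "(inv has_derivative I) (at (f (\<zeta> t)))"
      by (rule has_derivative_inverse_strong[OF open_ball \<zeta>_disk[OF t] cont _ df[OF \<zeta>_disk[OF t], folded a_def b_def] comp])
         (rule inv_f)
    have "((\<lambda>s. f 0 + of_real s * e) has_derivative (\<lambda>s. of_real s * e)) (at t)"
      by (auto intro!: derivative_eq_intros)
    hence "((\<lambda>s. inv (f 0 + of_real s * e)) has_derivative (\<lambda>s. I (of_real s * e))) (at t)"
      using dinv unfolding f\<zeta>'[OF t] by (rule has_derivative_compose)
    moreover have "(\<lambda>s. I (complex_of_real s * e)) = (\<lambda>s. s *\<^sub>R I e)"
      by (auto simp: I_def fun_eq_iff scaleR_conv_of_real algebra_simps)
    ultimately have "(\<zeta> has_vector_derivative I e) (at t)"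
      by (simp add: has_vector_derivative_def \<zeta>_def[abs_def])
    moreover have "a * I e + cnj (b * I e) = e" using fun_cong[OF comp, of e] by simp
    ultimately show ?thesis unfolding a_def b_def by blast
  qed
  define \<psi> where "\<psi> t = G (cmod (\<zeta> t))" for t
  have "continuous_on {0..1} \<zeta>"
    using d\<zeta> by (meson continuous_at_imp_continuous_on has_vector_derivative_continuous)
  moreover have "continuous_on {0..<1} G"
    using dG by (meson DERIV_isCont atLeastLessThan_iff continuous_at_imp_continuous_on)
  ultimately have cont_\<psi>: "continuous_on {0..1} \<psi>"
    unfolding \<psi>_def[abs_def] using \<zeta>_disk
    by (intro continuous_on_compose2[of "{0..<1}" G "{0..1}" "\<lambda>t. cmod (\<zeta> t)"] continuous_on_norm) auto
  have d\<psi>: "\<exists>y. (\<psi> has_field_derivative y) (at t) \<and> y \<le> cmod e" if t: "0 < t" "t < 1" for t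
  proof -
    obtain v where v: "(\<zeta> has_vector_derivative v) (at t)"
        "deriv h (\<zeta> t) * v + cnj (deriv g (\<zeta> t) * v) = e" using d\<zeta>[of t] t by auto
    have zd: "\<zeta> t \<in> unit_disk" using \<zeta>_disk[of t] t by simp
    have z1: "cmod (\<zeta> t) < 1" using zd by simp
    have nz: "\<zeta> t \<noteq> 0"
    proof
      assume "\<zeta> t = 0"
      with f\<zeta>'[of t] t e show False by simp
    qed
    have "((\<lambda>t. cmod (\<zeta> t)) has_derivative (\<lambda>s. (s *\<^sub>R v) \<bullet> sgn (\<zeta> t))) (at t)"
      using has_derivative_compose[OF v(1)[unfolded has_vector_derivative_def] has_derivative_norm[OF nz]] .
    hence dn: "((\<lambda>t. cmod (\<zeta> t)) has_field_derivative (v \<bullet> sgn (\<zeta> t))) (at t)"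
      by (simp add: has_field_derivative_def mult.commute[of _ "v \<bullet> _"])
    have "(\<psi> has_field_derivative G' (cmod (\<zeta> t)) * (v \<bullet> sgn (\<zeta> t))) (at t)"
      using DERIV_chain2[OF dG[OF norm_ge_zero z1] dn] by (simp add: \<psi>_def[abs_def])
    moreover have "G' (cmod (\<zeta> t)) * (v \<bullet> sgn (\<zeta> t)) \<le> cmod e"
    proof -
      have "v \<bullet> sgn (\<zeta> t) \<le> cmod v * cmod (sgn (\<zeta> t))"
        by (rule norm_cauchy_schwarz)
      also have "\<dots> = cmod v" using nz by (simp add: norm_sgn)
      finally have "G' (cmod (\<zeta> t)) * (v \<bullet> sgn (\<zeta> t)) \<le> G' (cmod (\<zeta> t)) * cmod v"
        using G'_nonneg z1 by (intro mult_left_mono) auto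
      also have "\<dots> \<le> (cmod (deriv h (\<zeta> t)) - cmod (deriv g (\<zeta> t))) * cmod v"
        using bound[OF zd] by (intro mult_right_mono) auto
      also have "\<dots> \<le> cmod e"
        using min_stretch_mult_le_norm[of "deriv h (\<zeta> t)" "deriv g (\<zeta> t)" v] v(2) by simp
      finally show ?thesis .
    qed
    ultimately show ?thesis by blast
  qed
  \<comment> \<open>The mean value theorem with differentiability on the open interval only: \<open>|\<zeta>|\<close> need not be
    differentiable at \<open>t = 0\<close>, where \<open>\<zeta> t = 0\<close>.\<close>
  obtain l t where lt: "0 < t" "t < 1" "(\<psi> has_field_derivative l) (at t)" "\<psi> 1 - \<psi> 0 = (1 - 0) * l"
    using MVT[OF zero_less_one cont_\<psi>] d\<psi> real_differentiable_def by blast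
  have "l \<le> cmod e" using d\<psi>[OF lt(1,2)] DERIV_unique[OF lt(3)] by blast
  hence "G \<rho> - G 0 \<le> cmod e" using lt(4) by (simp add: \<psi>_def \<zeta>0 \<zeta>1 z0)
  also have "\<dots> \<le> cmod (f z - f 0)" using min[of z] by (simp add: e_def \<rho>_def)
  finally show ?thesis by (simp add: \<rho>_def)
qed simp


text \<open>Here \<open>G\<close> is the primitive of the lower bound for \<open>|h'| - |g'|\<close>.\<close>

lemma univalent_pair_growth:
  assumes coeff: "second_coeff_bound \<alpha>" and \<alpha>: "\<alpha> > 0" and hg: "univalent_pair h g" and z: "z \<in> unit_disk"
    and f_def: "\<And>z. f z = h z + cnj (g z)"
  shows "(cmod (deriv h 0) - cmod (deriv g 0)) / (2 * \<alpha>) * (1 - ((1 - cmod z) / (1 + cmod z)) powr \<alpha>)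
    \<le> cmod (f z - f 0)"
proof -
  define b where "b = cmod (deriv h 0) - cmod (deriv g 0)"
  have b: "b > 0" using hg unfolding univalent_pair_def b_def by force
  define G where "G t = - b / (2 * \<alpha>) * ((1 - t) / (1 + t)) powr \<alpha>" for t :: real
  define G' where "G' t = b * ((1 - t) / (1 + t)) powr \<alpha> / (1 - t\<^sup>2)" for t :: real
  have sq: "1 - t\<^sup>2 > 0" if "0 \<le> t" "t < 1" for t :: real
    using that by (simp add: abs_square_less_1)
  have "G (cmod z) - G 0 \<le> cmod (f z - f 0)"
  proof (rule growth_of_min_stretch_bound[OF hg z f_def])
    fix t :: real assume t: "0 \<le> t" "t < 1"
    show "G' t \<ge> 0" using b sq[OF t] by (simp add: G'_def)
    define u where "u = (1 - t) / (1 + t)"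
    have u: "u > 0" using t by (simp add: u_def)
    have du: "((\<lambda>t. (1 - t) / (1 + t)) has_field_derivative (- 2 / (1 + t)\<^sup>2)) (at t)"
      using t by (auto intro!: derivative_eq_intros simp: field_simps power2_eq_square)
    have "(G has_field_derivative (- b / (2 * \<alpha>) * (\<alpha> * u powr (\<alpha> - 1) * (- 2 / (1 + t)\<^sup>2)))) (at t)"
      unfolding G_def[abs_def]
      by (intro DERIV_cmult DERIV_chain2[OF has_real_derivative_powr[OF u, unfolded u_def] du, folded u_def])
    moreover have "- b / (2 * \<alpha>) * (\<alpha> * u powr (\<alpha> - 1) * (- 2 / (1 + t)\<^sup>2)) = G' t"
    proof -
      have "u powr (\<alpha> - 1) = u powr \<alpha> / u" using u by (simp add: powr_diff)
      hence "- b / (2 * \<alpha>) * (\<alpha> * u powr (\<alpha> - 1) * (- 2 / (1 + t)\<^sup>2)) = b * u powr \<alpha> / (u * (1 + t)\<^sup>2)"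
        using \<alpha> by simp
      also have "u * (1 + t)\<^sup>2 = 1 - t\<^sup>2"
        using t by (simp add: u_def field_simps power2_eq_square)
      finally show ?thesis by (simp add: G'_def u_def)
    qed
    ultimately show "(G has_field_derivative G' t) (at t)" by simp
  next
    fix w :: complex assume w: "w \<in> unit_disk"
    show "G' (cmod w) \<le> cmod (deriv h w) - cmod (deriv g w)"
      using min_stretch_lower_bound[OF coeff hg w] sq[of "cmod w"] w
      unfolding G'_def b_def by (subst pos_divide_le_eq) (auto simp: mult.commute)
  qed
  also have "G (cmod z) - G 0 = b / (2 * \<alpha>) * (1 - ((1 - cmod z) / (1 + cmod z)) powr \<alpha>)"
    by (simp add: G_def right_diff_distrib)
  finally show ?thesis by (simp add: b_def)
qed

section \<open>Separation of two points\<close>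

lemma norm_one_minus_cnj_mult:
  "(cmod (1 - cnj w * z))\<^sup>2 = (cmod (w - z))\<^sup>2 + (1 - (cmod w)\<^sup>2) * (1 - (cmod z)\<^sup>2)"
proof -
  have "complex_of_real ((cmod (1 - cnj w * z))\<^sup>2) =
      complex_of_real ((cmod (w - z))\<^sup>2 + (1 - (cmod w)\<^sup>2) * (1 - (cmod z)\<^sup>2))"
    unfolding of_real_add of_real_diff of_real_mult of_real_1 complex_norm_square
    by (simp add: algebra_simps)
  thus ?thesis by (simp only: of_real_eq_iff)
qed

text \<open>For a given Euclidean distance \<open>2 * s\<close> the pseudohyperbolic distance is least for the pair
  \<open>s, -s\<close>, for which it equals \<open>2 * s / (1 + s^2)\<close>: among points at this distance,
  \<open>(1 - |w|^2) (1 - |z|^2)\<close> is largest there.\<close>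

lemma pseudohyperbolic_lower_bound:
  assumes "w \<in> unit_disk" "z \<in> unit_disk"
  defines "s \<equiv> cmod (w - z) / 2"
  shows "2 * s / (1 + s\<^sup>2) \<le> cmod (Moebius_function 0 w z)"
proof -
  define m where "m = (cmod w + cmod z) / 2"
  have m: "s \<le> m" "m \<le> 1"
    using assms norm_triangle_ineq4[of w z] by (auto simp: m_def)
  have "(1 - (cmod w)\<^sup>2) * (1 - (cmod z)\<^sup>2) \<le> (1 - m\<^sup>2)\<^sup>2"
  proof -
    define \<delta> where "\<delta> = (cmod w - cmod z) / 2"
    have wz: "cmod w = m + \<delta>" "cmod z = m - \<delta>" by (auto simp: m_def \<delta>_def field_simps)
    have "(1 - m\<^sup>2)\<^sup>2 - (1 - (cmod w)\<^sup>2) * (1 - (cmod z)\<^sup>2) = \<delta>\<^sup>2 * (2 + 2 * m\<^sup>2 - \<delta>\<^sup>2)"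
      unfolding wz by algebra
    moreover have "\<delta>\<^sup>2 \<le> 1\<^sup>2"
    proof -
      have "cmod w < 1" "cmod z < 1" using assms(1,2) by auto
      hence "cmod w - cmod z \<le> 2" "- 2 \<le> cmod w - cmod z"
        using norm_ge_zero[of w] norm_ge_zero[of z] by linarith+
      hence "\<bar>\<delta>\<bar> \<le> 1"
        by (simp add: \<delta>_def abs_le_iff)
      thus ?thesis by (simp add: abs_square_le_1)
    qed
    moreover have "m\<^sup>2 \<ge> 0" by simp
    ultimately show ?thesis
      by (smt (verit) mult_nonneg_nonneg zero_le_power2 one_power2)
  qed
  also have "\<dots> \<le> (1 - s\<^sup>2)\<^sup>2"
  proof (rule power_mono)
    have "0 \<le> s" by (simp add: s_def)
    thus "1 - m\<^sup>2 \<le> 1 - s\<^sup>2" using m(1) by (simp add: power_mono)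
    show "0 \<le> 1 - m\<^sup>2" using m \<open>0 \<le> s\<close> by (simp add: power_le_one)
  qed
  finally have "(cmod (1 - cnj w * z))\<^sup>2 \<le> (2 * s)\<^sup>2 + (1 - s\<^sup>2)\<^sup>2"
    unfolding norm_one_minus_cnj_mult by (simp add: s_def)
  also have "\<dots> = (1 + s\<^sup>2)\<^sup>2" by algebra
  finally have le: "cmod (1 - cnj w * z) \<le> 1 + s\<^sup>2"
    by (rule power2_le_imp_le) simp
  have "1 - cnj w * z \<noteq> 0"
    using Moebius_denominator_nonzero[of "-w" z] assms by simp
  hence "2 * s / (1 + s\<^sup>2) \<le> cmod (w - z) / cmod (1 - cnj w * z)"
    using le by (auto simp: s_def intro!: divide_left_mono mult_pos_pos add_pos_nonneg)
  thus ?thesis by (simp add: Moebius_function_simple norm_divide norm_minus_commute)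
qed

text \<open>The growth theorem for \<open>f\<close> composed with the automorphism that sends \<open>0\<close> to \<open>w\<close>, combined with
  the lower bound for \<open>|h'| - |g'|\<close> at \<open>w\<close>. The pseudohyperbolic distance of \<open>w\<close> and \<open>z\<close> enters the growth
  theorem; replacing it by its least value turns the exponent \<open>\<alpha>\<close> into \<open>2 * \<alpha>\<close>.\<close>

lemma univalent_pair_two_point:
  assumes coeff: "second_coeff_bound \<alpha>" and \<alpha>: "\<alpha> > 0" and hg: "univalent_pair h g"
    and w: "w \<in> unit_disk" and z: "z \<in> unit_disk"
    and f_def: "\<And>z. f z = h z + cnj (g z)"
  defines "s \<equiv> cmod (w - z) / 2"
  shows "(cmod (deriv h 0) - cmod (deriv g 0)) * ((1 - cmod w) / (1 + cmod w)) powr \<alpha>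
      / (2 * \<alpha>) * (1 - ((1 - s) / (1 + s)) powr (2 * \<alpha>)) \<le> cmod (f z - f w)"
proof -
  define M where "M = Moebius_function 0 (-w)"
  define \<zeta> where "\<zeta> = Moebius_function 0 w z"
  define l where "l = (1 - (cmod w)\<^sup>2) * (cmod (deriv h w) - cmod (deriv g w))"
  define b where "b = cmod (deriv h 0) - cmod (deriv g 0)"
  have b: "b > 0" using hg unfolding univalent_pair_def b_def by force
  have w': "cmod w < 1" and z': "cmod z < 1" using w z by auto
  have w2: "1 - (cmod w)\<^sup>2 > 0" using w' by (simp add: abs_square_less_1)
  have \<zeta>: "cmod \<zeta> < 1" using Moebius_function_norm_lt_1[OF w' z'] by (simp add: \<zeta>_def)
  have M0: "M 0 = w" by (simp add: M_def Moebius_function_of_zero)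
  have M\<zeta>: "M \<zeta> = z" unfolding M_def \<zeta>_def by (rule Moebius_function_compose) (use w' z' in auto)
  have s: "0 \<le> s" "s < 1" using norm_triangle_ineq4[of w z] w' z' by (auto simp: s_def)
  have dM: "cmod (deriv (\<lambda>z. k (M z)) 0) = (1 - (cmod w)\<^sup>2) * cmod (deriv k w)" if "k holomorphic_on unit_disk" for k
  proof -
    have "deriv (\<lambda>z. k (M z)) 0 = deriv k w * of_real (1 - (cmod w)\<^sup>2)"
      using deriv_comp_Moebius[OF that w, of 0] by (simp add: M_def[symmetric] M0)
    thus ?thesis using w2 by (simp only: norm_mult norm_of_real) simp
  qed
  have hol: "h holomorphic_on unit_disk" "g holomorphic_on unit_disk"
    using hg by (auto simp: univalent_pair_def)
  have "cmod (deriv (\<lambda>z. h (M z)) 0) - cmod (deriv (\<lambda>z. g (M z)) 0) = l"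
    by (simp add: dM hol l_def algebra_simps)
  hence *: "l / (2 * \<alpha>) * (1 - ((1 - cmod \<zeta>) / (1 + cmod \<zeta>)) powr \<alpha>) \<le> cmod (f z - f w)"
    using univalent_pair_growth[OF coeff \<alpha> univalent_pair_Moebius[OF hg w, folded M_def], of \<zeta> "\<lambda>z. f (M z)"]
    by (simp add: \<zeta> f_def M0 M\<zeta>)
  have quot: "(1 - cmod \<zeta>) / (1 + cmod \<zeta>) \<le> ((1 - s) / (1 + s))\<^sup>2"
  proof -
    define y where "y = 2 * s / (1 + s\<^sup>2)"
    have "1 + s\<^sup>2 > 0" by (simp add: add_pos_nonneg)
    hence y: "0 \<le> y" "(1 - y) / (1 + y) = ((1 - s) / (1 + s))\<^sup>2"
      using s by (auto simp: y_def divide_simps power2_eq_square) (simp_all add: algebra_simps)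
    have "y \<le> cmod \<zeta>" unfolding y_def s_def \<zeta>_def by (rule pseudohyperbolic_lower_bound[OF w z])
    hence "(1 - cmod \<zeta>) / (1 + cmod \<zeta>) \<le> (1 - y) / (1 + y)"
      using \<zeta> y(1) by (intro frac_le) auto
    thus ?thesis using y(2) by simp
  qed
  have "((1 - cmod \<zeta>) / (1 + cmod \<zeta>)) powr \<alpha> \<le> (((1 - s) / (1 + s))\<^sup>2) powr \<alpha>"
    using \<alpha> \<zeta> by (intro powr_mono2 quot) auto
  also have "\<dots> = ((1 - s) / (1 + s)) powr (2 * \<alpha>)"
    using s by (simp add: powr_powr[symmetric])
  finally have pw: "((1 - cmod \<zeta>) / (1 + cmod \<zeta>)) powr \<alpha> \<le> ((1 - s) / (1 + s)) powr (2 * \<alpha>)" .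
  have "((1 - s) / (1 + s)) powr (2 * \<alpha>) \<le> 1 powr (2 * \<alpha>)"
    using s \<alpha> by (intro powr_mono2) auto
  hence nn: "0 \<le> 1 - ((1 - s) / (1 + s)) powr (2 * \<alpha>)" by simp
  have bl: "b * ((1 - cmod w) / (1 + cmod w)) powr \<alpha> \<le> l"
    using min_stretch_lower_bound[OF coeff hg w] by (simp add: b_def l_def)
  have "b * ((1 - cmod w) / (1 + cmod w)) powr \<alpha> / (2 * \<alpha>) * (1 - ((1 - s) / (1 + s)) powr (2 * \<alpha>))
    \<le> l / (2 * \<alpha>) * (1 - ((1 - s) / (1 + s)) powr (2 * \<alpha>))"
    using nn \<alpha> bl by (intro mult_right_mono divide_right_mono) auto
  also have "\<dots> \<le> l / (2 * \<alpha>) * (1 - ((1 - cmod \<zeta>) / (1 + cmod \<zeta>)) powr \<alpha>)"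
  proof (rule mult_left_mono)
    have "0 \<le> b * ((1 - cmod w) / (1 + cmod w)) powr \<alpha>" using b by simp
    with bl \<alpha> show "0 \<le> l / (2 * \<alpha>)" by simp
  qed (use pw in simp)
  also note *
  finally show ?thesis by (simp add: b_def)
qed

text \<open>The function \<open>s \<mapsto> 1 - ((1 - s) / (1 + s)) powr \<beta>\<close> is concave for \<open>\<beta> \<ge> 1\<close> and vanishes
  at \<open>0\<close>, so on \<open>[0, r]\<close> its graph lies above the chord.\<close>

lemma one_minus_quotient_powr_ge:
  fixes \<beta> r s :: real
  assumes "\<beta> \<ge> 1" "0 \<le> s" "s \<le> r" "0 < r" "r < 1"
  shows "s / r * (1 - ((1 - r) / (1 + r)) powr \<beta>) \<le> 1 - ((1 - s) / (1 + s)) powr \<beta>"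
proof -
  define t where "t = s / r"
  define \<rho> where "\<rho> = (1 - r) / (1 + r)"
  have t: "0 \<le> t" "t \<le> 1" "s = t * r" using assms by (auto simp: t_def)
  have \<rho>: "\<rho> > 0" using assms by (simp add: \<rho>_def)
  have "(1 - t) + t * \<rho> - (1 - s) / (1 + s) = 2 * t * (1 - t) * r\<^sup>2 / ((1 + r) * (1 + s))"
    using assms(4) assms(2) unfolding \<rho>_def t(3)
    by (simp add: divide_simps power2_eq_square add_pos_nonneg) (simp add: algebra_simps)
  moreover have "2 * t * (1 - t) * r\<^sup>2 / ((1 + r) * (1 + s)) \<ge> 0"
    using t assms by (intro divide_nonneg_nonneg mult_nonneg_nonneg) auto
  ultimately have "(1 - s) / (1 + s) \<le> (1 - t) * 1 + t * \<rho>" by simp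
  hence "((1 - s) / (1 + s)) powr \<beta> \<le> ((1 - t) * 1 + t * \<rho>) powr \<beta>"
    using assms by (intro powr_mono2) auto
  also have "\<dots> \<le> (1 - t) * 1 powr \<beta> + t * \<rho> powr \<beta>"
    using convex_onD[OF powr_convex[OF assms(1)], of t 1 \<rho>] t \<rho> by simp
  finally show ?thesis
    by (simp add: t_def[symmetric] \<rho>_def[symmetric] algebra_simps)
qed

text \<open>The separation of points that the perturbation argument consumes. Concavity makes the two-point bound
  linear in \<open>|w - z|\<close>; it applies with exponent \<open>2 * \<alpha>\<close>, whence \<open>\<alpha> \<ge> 1 / 2\<close>.\<close>

lemma univalent_pair_two_point_cball:
  assumes coeff: "second_coeff_bound \<alpha>" and \<alpha>: "\<alpha> \<ge> 1 / 2" and hg: "univalent_pair h g"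
    and r: "0 < r" "r < 1" and w: "cmod w \<le> r" and z: "cmod z \<le> r"
    and f_def: "\<And>z. f z = h z + cnj (g z)"
  shows "(cmod (deriv h 0) - cmod (deriv g 0)) *
      (1 / (4 * \<alpha> * r) * ((1 - r) / (1 + r)) powr \<alpha> * (1 - ((1 - r) / (1 + r)) powr (2 * \<alpha>))) * cmod (w - z)
    \<le> cmod (f z - f w)"
proof -
  define b where "b = cmod (deriv h 0) - cmod (deriv g 0)"
  define \<rho> where "\<rho> = (1 - r) / (1 + r)"
  define s where "s = cmod (w - z) / 2"
  have b: "b > 0" using hg unfolding univalent_pair_def b_def by force
  have s: "0 \<le> s" "s \<le> r" using norm_triangle_ineq4[of w z] w z by (auto simp: s_def)
  have quot: "\<rho> \<le> (1 - cmod w) / (1 + cmod w)"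
    unfolding \<rho>_def using w r by (intro frac_le) (auto simp: add_pos_nonneg)
  have "((1 - s) / (1 + s)) powr (2 * \<alpha>) \<le> 1 powr (2 * \<alpha>)"
    using s \<alpha> r by (intro powr_mono2) auto
  hence nn: "0 \<le> 1 - ((1 - s) / (1 + s)) powr (2 * \<alpha>)" by simp
  have "b * (1 / (4 * \<alpha> * r) * \<rho> powr \<alpha> * (1 - \<rho> powr (2 * \<alpha>))) * cmod (w - z)
      = b * \<rho> powr \<alpha> / (2 * \<alpha>) * (s / r * (1 - \<rho> powr (2 * \<alpha>)))"
    by (simp add: s_def field_simps)
  also have "\<dots> \<le> b * ((1 - cmod w) / (1 + cmod w)) powr \<alpha> / (2 * \<alpha>) * (1 - ((1 - s) / (1 + s)) powr (2 * \<alpha>))"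
  proof (rule mult_mono)
    show "s / r * (1 - \<rho> powr (2 * \<alpha>)) \<le> 1 - ((1 - s) / (1 + s)) powr (2 * \<alpha>)"
      unfolding \<rho>_def by (rule one_minus_quotient_powr_ge) (use \<alpha> r s in auto)
    show "b * \<rho> powr \<alpha> / (2 * \<alpha>) \<le> b * ((1 - cmod w) / (1 + cmod w)) powr \<alpha> / (2 * \<alpha>)"
      using b \<alpha> r quot by (intro divide_right_mono mult_left_mono powr_mono2) (auto simp: \<rho>_def)
    have "\<rho> powr (2 * \<alpha>) \<le> 1 powr (2 * \<alpha>)"
      using \<alpha> r by (intro powr_mono2) (auto simp: \<rho>_def)
    thus "0 \<le> s / r * (1 - \<rho> powr (2 * \<alpha>))" using s r by simp
  qed (use b \<alpha> nn in auto)
  also have "\<dots> \<le> cmod (f z - f w)"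
    unfolding b_def s_def by (rule univalent_pair_two_point[OF coeff _ hg _ _ f_def]) (use \<alpha> w z r in auto)
  finally show ?thesis by (simp add: b_def \<rho>_def)
qed

section \<open>The order of the normalized family\<close>

text \<open>An infinite supremum is turned into \<open>0\<close> by the coercion to the reals, so a nonzero order is the
  supremum itself.\<close>

lemma S_H_coeff_le_ord:
  assumes "ord_S_H \<noteq> 0" "(h, g) \<in> S_H"
  shows "cmod (deriv (deriv h) 0 / 2) \<le> ord_S_H"
proof -
  define S where "S = (SUP (h, g)\<in>S_H. ereal (cmod (deriv (deriv h) 0 / 2)))"
  have "ereal ord_S_H = S"
    using assms(1) unfolding ord_S_H_def S_def[symmetric] by (cases S) auto
  moreover have "ereal (cmod (deriv (deriv h) 0 / 2)) \<le> S"
    unfolding S_def by (rule SUP_upper2[OF assms(2)]) simp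
  ultimately show ?thesis by (metis ereal_less_eq(3))
qed

text \<open>Every univalent pair becomes a member of \<open>S_H\<close> after subtracting \<open>f 0\<close> and dividing by \<open>h' 0\<close>.\<close>

lemma second_coeff_bound_ord:
  assumes "ord_S_H \<noteq> 0"
  shows "second_coeff_bound ord_S_H"
  unfolding second_coeff_bound_def
proof (intro allI impI)
  fix h g assume "univalent_pair h g"
  note hg = this[unfolded univalent_pair_def]
  define a where "a = deriv h 0"
  have a: "a \<noteq> 0" using univalent_pair_deriv_nonzero[OF \<open>univalent_pair h g\<close>, of 0] by (simp add: a_def)
  define H where "H z = (h z - h 0) / a" for z
  define K where "K z = (g z - g 0) / cnj a" for z
  have H: "(H has_field_derivative deriv h z / a) (at z)" and K: "(K has_field_derivative deriv g z / cnj a) (at z)"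
    if "z \<in> unit_disk" for z
    unfolding H_def[abs_def] K_def[abs_def]
    using holomorphic_disk_has_field_derivative[of h z] holomorphic_disk_has_field_derivative[of g z] hg that a
    by (auto intro!: derivative_eq_intros)
  have dH: "deriv H z = deriv h z / a" and dK: "deriv K z = deriv g z / cnj a" if "z \<in> unit_disk" for z
    using H[OF that] K[OF that] by (auto intro: DERIV_imp_deriv)
  have hol: "H holomorphic_on unit_disk" "K holomorphic_on unit_disk"
    using hg a by (auto simp: H_def[abs_def] K_def[abs_def] intro!: holomorphic_intros)
  have F: "H z + cnj (K z) = ((h z + cnj (g z)) - (h 0 + cnj (g 0))) / a" for z
    by (simp add: H_def K_def diff_divide_distrib add_divide_distrib)
  have "univalent (\<lambda>z. H z + cnj (K z))"
    unfolding univalent_def F using hg a unfolding inj_on_def by auto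
  moreover have "sense_preserving (\<lambda>z. H z + cnj (K z))"
    unfolding sense_preserving_def
    by (rule exI[of _ H], rule exI[of _ K])
       (use hol hg a in \<open>auto simp: harmonic_rep_def harmonic_jacobian_pos_iff dH dK norm_divide divide_strict_right_mono\<close>)
  ultimately have "(H, K) \<in> S_H"
    using hol a dH[of 0] by (auto simp: S_H_def H_def K_def a_def)
  hence le: "cmod (deriv (deriv H) 0 / 2) \<le> ord_S_H"
    by (rule S_H_coeff_le_ord[OF assms])
  have "(deriv h has_field_derivative deriv (deriv h) 0) (at 0)"
    using hg by (intro holomorphic_disk_has_field_derivative) (auto intro: holomorphic_deriv)
  hence "((\<lambda>z. deriv h z / a) has_field_derivative deriv (deriv h) 0 / a) (at 0)"
    by (rule DERIV_cdivide)
  hence "(deriv H has_field_derivative deriv (deriv h) 0 / a) (at 0)"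
    by (rule has_field_derivative_transform_within_open[of _ _ _ unit_disk]) (auto simp: dH)
  hence "deriv (deriv H) 0 = deriv (deriv h) 0 / a" by (rule DERIV_imp_deriv)
  with le show "cmod (deriv (deriv h) 0 / 2) \<le> ord_S_H * cmod (deriv h 0)"
    using a by (simp add: norm_divide field_simps a_def)
qed

text \<open>The polynomial \<open>z + z^2 / 2\<close> is univalent on the disk, being \<open>((1 + z)^2 - 1) / 2\<close>, and its second
  coefficient is \<open>1 / 2\<close>.\<close>

lemma ord_S_H_ge_half:
  assumes "ord_S_H \<noteq> 0"
  shows "ord_S_H \<ge> 1 / 2"
proof -
  define h :: "complex \<Rightarrow> complex" where "h z = z + z\<^sup>2 / 2" for z
  have dh: "deriv h = (\<lambda>z. 1 + z)"
    unfolding h_def by (intro ext DERIV_imp_deriv) (auto intro!: derivative_eq_intros)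
  have nz: "1 + z \<noteq> 0" if "cmod z < 1" for z :: complex
    using that by (metis add_eq_0_iff norm_minus_cancel norm_one order_less_irrefl)
  have "inj_on h unit_disk"
  proof (rule inj_onI)
    fix w z assume wz: "w \<in> unit_disk" "z \<in> unit_disk" "h w = h z"
    have "(w - z) * (1 + (w + z) / 2) = h w - h z"
      by (simp add: h_def field_simps power2_eq_square)
    moreover have "1 + (w + z) / 2 \<noteq> 0"
      using nz[of "(w + z) / 2"] norm_triangle_ineq[of w z] wz(1,2) by (simp add: norm_divide)
    ultimately show "w = z" using wz(3) by simp
  qed
  moreover have hol: "h holomorphic_on unit_disk"
    unfolding h_def[abs_def] by (intro holomorphic_intros) auto
  moreover have "sense_preserving h"
    unfolding sense_preserving_def
    by (rule exI[of _ h], rule exI[of _ "\<lambda>_. 0"])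
       (use hol nz in \<open>auto simp: harmonic_rep_def harmonic_jacobian_def dh\<close>)
  ultimately have "(h, \<lambda>_. 0) \<in> S_H"
    by (simp add: S_H_def univalent_def dh) (simp add: h_def)
  moreover have "deriv (deriv h) 0 = 1"
    unfolding dh by (intro DERIV_imp_deriv) (auto intro!: derivative_eq_intros)
  ultimately show ?thesis using S_H_coeff_le_ord[OF assms] by fastforce
qed

lemma C_bound_nonzero_imp_ord_nonzero: "C_bound r \<noteq> 0 \<Longrightarrow> ord_S_H \<noteq> 0"
  by (auto simp: C_bound_def)

section \<open>Perturbation\<close>

lemma harmonic_Lipschitz:
  assumes "harmonic_rep \<phi> p q"
    and A: "\<And>z. z \<in> unit_disk \<Longrightarrow> cmod (deriv p z) + cmod (deriv q z) \<le> A"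
    and "w \<in> unit_disk" "z \<in> unit_disk"
  shows "cmod (\<phi> w - \<phi> z) \<le> A * cmod (w - z)"
proof -
  have rep: "p holomorphic_on unit_disk" "q holomorphic_on unit_disk"
    "\<And>z. z \<in> unit_disk \<Longrightarrow> \<phi> z = p z + cnj (q z)"
    using assms(1) by (auto simp: harmonic_rep_def)
  have "cmod ((p w + cnj (q w)) - (p z + cnj (q z))) \<le> A * cmod (w - z)"
  proof (rule differentiable_bound[where S = unit_disk])
    fix x :: complex assume x: "x \<in> unit_disk"
    show "((\<lambda>z. p z + cnj (q z)) has_derivative (\<lambda>v. deriv p x * v + cnj (deriv q x * v))) (at x within unit_disk)"
      by (rule has_derivative_at_withinI[OF harmonic_has_derivative[OF rep(1,2) x]])
    show "onorm (\<lambda>v. deriv p x * v + cnj (deriv q x * v)) \<le> A"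
    proof (rule onorm_le)
      fix v
      have "cmod (deriv p x * v + cnj (deriv q x * v)) \<le> (cmod (deriv p x) + cmod (deriv q x)) * cmod v"
        using norm_triangle_ineq[of "deriv p x * v" "cnj (deriv q x * v)"] by (simp add: norm_mult algebra_simps)
      also have "\<dots> \<le> A * cmod v" using A[OF x] by (intro mult_right_mono) auto
      finally show "cmod (deriv p x * v + cnj (deriv q x * v)) \<le> A * cmod v" .
    qed
  qed (use assms in auto)
  thus ?thesis using rep(3) assms(3,4) by simp
qed

text \<open>A perturbation with Lipschitz constant \<open>\<epsilon> * A\<close> can neither identify two points nor reverse the
  orientation if \<open>z \<mapsto> f (r z)\<close> expands distances, respectively tangent vectors, by more than that factor.\<close>

lemma univalent_sense_preserving_perturbation:
  assumes hg: "univalent_pair h g" and f: "harmonic_rep f h g" and phi: "harmonic_rep \<phi> p q"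
    and r: "0 < r" "r < 1" and \<epsilon>: "0 \<le> \<epsilon>"
    and A: "\<And>z. z \<in> unit_disk \<Longrightarrow> cmod (deriv p z) + cmod (deriv q z) \<le> A"
    and jac: "\<And>z. z \<in> cball 0 r \<Longrightarrow> \<epsilon> * A < r * (cmod (deriv h z) - cmod (deriv g z))"
    and sep: "\<And>w z. w \<in> cball 0 r \<Longrightarrow> z \<in> cball 0 r \<Longrightarrow> w \<noteq> z \<Longrightarrow>
      \<epsilon> * A * cmod (w - z) < r * cmod (f w - f z)"
  shows "univalent (\<lambda>z. f (of_real r * z) + of_real \<epsilon> * \<phi> z)"
    and "sense_preserving (\<lambda>z. f (of_real r * z) + of_real \<epsilon> * \<phi> z)"
proof -
  have cb: "of_real r * z \<in> cball 0 r" and disk: "of_real r * z \<in> unit_disk" if "z \<in> unit_disk" for z :: complex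
  proof -
    have "r * cmod z \<le> r * 1" using that r by (intro mult_left_mono) auto
    thus "of_real r * z \<in> cball 0 r" using r by (simp add: norm_mult)
    thus "of_real r * z \<in> unit_disk" using r by simp
  qed
  show "univalent (\<lambda>z. f (of_real r * z) + of_real \<epsilon> * \<phi> z)"
    unfolding univalent_def
  proof (rule inj_onI, rule ccontr)
    fix w z assume wz: "w \<in> unit_disk" "z \<in> unit_disk" "w \<noteq> z"
      "f (of_real r * w) + of_real \<epsilon> * \<phi> w = f (of_real r * z) + of_real \<epsilon> * \<phi> z"
    have "cmod (of_real r * w - of_real r * z) = r * cmod (w - z)"
      using r by (simp add: norm_mult flip: right_diff_distrib)
    hence "r * (\<epsilon> * (A * cmod (w - z))) < r * cmod (f (of_real r * w) - f (of_real r * z))"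
      using sep[OF cb[OF wz(1)] cb[OF wz(2)]] wz(3) r by (simp add: mult_ac)
    hence "\<epsilon> * (A * cmod (w - z)) < cmod (f (of_real r * w) - f (of_real r * z))"
      using r by simp
    also have "f (of_real r * w) - f (of_real r * z) = of_real \<epsilon> * (\<phi> z - \<phi> w)"
      using wz(4) by (simp add: algebra_simps)
    also have "cmod \<dots> = \<epsilon> * cmod (\<phi> w - \<phi> z)" using \<epsilon> by (simp add: norm_mult norm_minus_commute)
    also have "\<dots> \<le> \<epsilon> * (A * cmod (w - z))"
      using harmonic_Lipschitz[OF phi A wz(1,2)] \<epsilon> by (intro mult_left_mono) auto
    finally show False by simp
  qed
  define H where "H z = h (of_real r * z) + of_real \<epsilon> * p z" for z
  define K where "K z = g (of_real r * z) + of_real \<epsilon> * q z" for z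
  have hol: "h holomorphic_on unit_disk" "g holomorphic_on unit_disk" "p holomorphic_on unit_disk" "q holomorphic_on unit_disk"
    using f phi by (auto simp: harmonic_rep_def)
  have d: "((\<lambda>z. k (of_real r * z) + of_real \<epsilon> * l z) has_field_derivative
      of_real r * deriv k (of_real r * z) + of_real \<epsilon> * deriv l z) (at z)"
    if "k holomorphic_on unit_disk" "l holomorphic_on unit_disk" "z \<in> unit_disk" for k l z
  proof -
    have "((\<lambda>z. of_real r * z) has_field_derivative of_real r) (at z)"
      by (auto intro!: derivative_eq_intros)
    from DERIV_chain'[OF this holomorphic_disk_has_field_derivative[OF that(1) disk[OF that(3)]]]
    show ?thesis
      by (intro DERIV_add DERIV_cmult holomorphic_disk_has_field_derivative that) (simp add: mult_ac)
  qed
  have "harmonic_rep (\<lambda>z. f (of_real r * z) + of_real \<epsilon> * \<phi> z) H K"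
    unfolding harmonic_rep_def
  proof (intro conjI ballI)
    have "(\<lambda>z. k (of_real r * z) + of_real \<epsilon> * l z) holomorphic_on unit_disk"
      if "k holomorphic_on unit_disk" "l holomorphic_on unit_disk" for k l
      unfolding holomorphic_on_open[OF open_ball] using d[OF that] by blast
    thus "H holomorphic_on unit_disk" "K holomorphic_on unit_disk"
      unfolding H_def[abs_def] K_def[abs_def] using hol by blast+
  qed (use f phi disk in \<open>auto simp: harmonic_rep_def H_def K_def algebra_simps\<close>)
  moreover have "cmod (deriv K z) < cmod (deriv H z)" if z: "z \<in> unit_disk" for z
  proof -
    define u where "u = of_real r * z"
    have dH: "deriv H z = of_real r * deriv h u + of_real \<epsilon> * deriv p z"
      unfolding H_def[abs_def] u_def by (intro DERIV_imp_deriv d hol z)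
    have dK: "deriv K z = of_real r * deriv g u + of_real \<epsilon> * deriv q z"
      unfolding K_def[abs_def] u_def by (intro DERIV_imp_deriv d hol z)
    have "\<epsilon> * cmod (deriv p z) + \<epsilon> * cmod (deriv q z) \<le> \<epsilon> * A"
      using A[OF z] \<epsilon> by (metis mult_left_mono distrib_left)
    moreover have "\<epsilon> * A < r * cmod (deriv h u) - r * cmod (deriv g u)"
      using jac[OF cb[OF z]] by (simp add: u_def algebra_simps)
    moreover have "cmod (deriv K z) \<le> r * cmod (deriv g u) + \<epsilon> * cmod (deriv q z)"
      using norm_triangle_ineq[of "of_real r * deriv g u" "of_real \<epsilon> * deriv q z"] r \<epsilon>
      by (simp add: dK norm_mult)
    moreover have "r * cmod (deriv h u) - \<epsilon> * cmod (deriv p z) \<le> cmod (deriv H z)"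
      using norm_diff_ineq[of "of_real r * deriv h u" "of_real \<epsilon> * deriv p z"] r \<epsilon>
      by (simp add: dH norm_mult)
    ultimately show ?thesis by linarith
  qed
  ultimately show "sense_preserving (\<lambda>z. f (of_real r * z) + of_real \<epsilon> * \<phi> z)"
    unfolding sense_preserving_def harmonic_jacobian_pos_iff by blast
qed

theorem theorem3:
  fixes f h g \<phi> p q :: "complex \<Rightarrow> complex" and A r \<epsilon> :: real
  assumes f_rep: "harmonic_rep f h g"
    and f_univalent: "univalent f"
    and f_sense: "sense_preserving f"
    and phi_rep: "harmonic_rep \<phi> p q"
    and A_finite: "bdd_above ((\<lambda>z. cmod (deriv p z) + cmod (deriv q z)) ` unit_disk)"
    and A_eq: "A = (SUP z\<in>unit_disk. cmod (deriv p z) + cmod (deriv q z))"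
    and r: "0 < r" "r < 1"
    and eps_nonneg: "0 \<le> \<epsilon>"
    and eps_less: "A \<noteq> 0 \<Longrightarrow> \<epsilon> < r / A * min (m_bound h g r) (m_bound h g 0 * C_bound r)"
  shows "univalent (\<lambda>z. f (of_real r * z) + of_real \<epsilon> * \<phi> z) \<and>
    sense_preserving (\<lambda>z. f (of_real r * z) + of_real \<epsilon> * \<phi> z)"
proof -
  have hg: "univalent_pair h g" by (rule univalent_pairI[OF f_rep f_univalent f_sense])
  have dil: "cmod (deriv h z) - cmod (deriv g z) > 0" if "z \<in> unit_disk" for z
    using hg that by (simp add: univalent_pair_def)
  have sub: "cball (0::complex) r \<subseteq> unit_disk" using r by auto
  have f_inj: "f w \<noteq> f z" if "w \<in> cball 0 r" "z \<in> cball 0 r" "w \<noteq> z" for w z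
    using f_univalent that sub unfolding univalent_def inj_on_def by blast
  have A_ge: "cmod (deriv p z) + cmod (deriv q z) \<le> A" if "z \<in> unit_disk" for z
    unfolding A_eq by (rule cSUP_upper[OF that A_finite])
  \<comment> \<open>If \<open>A = 0\<close>, both bounds hold for every \<open>\<epsilon>\<close> because the left hand sides vanish and the
    right hand sides are positive.\<close>
  have "(\<forall>z\<in>cball 0 r. \<epsilon> * A < r * (cmod (deriv h z) - cmod (deriv g z))) \<and>
    (\<forall>w\<in>cball 0 r. \<forall>z\<in>cball 0 r. w \<noteq> z \<longrightarrow> \<epsilon> * A * cmod (w - z) < r * cmod (f w - f z))"
  proof (cases "A = 0")
    case True
    show ?thesis
      unfolding True using r dil sub f_inj by (auto intro!: mult_pos_pos)
  next
    case False
    have "A \<ge> 0" using A_ge[of 0] by (smt (verit) centre_in_ball norm_ge_zero zero_less_one)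
    with False have A: "A > 0" by simp
    have less: "\<epsilon> * A < r * min (m_bound h g r) (m_bound h g 0 * C_bound r)"
      using eps_less[OF False] A by (simp add: field_simps)
    have less1: "\<epsilon> * A < r * m_bound h g r" and less2: "\<epsilon> * A < r * (m_bound h g 0 * C_bound r)"
      using less r by (smt (verit) min.cobounded1 min.cobounded2 mult_left_mono)+
    have jac: "\<epsilon> * A < r * (cmod (deriv h z) - cmod (deriv g z))" if z: "z \<in> cball 0 r" for z
    proof -
      have "bdd_below ((\<lambda>z. cmod (deriv h z) - cmod (deriv g z)) ` cball 0 r)"
        using dil sub by (intro bdd_belowI2[of _ 0] less_imp_le) blast
      hence "m_bound h g r \<le> cmod (deriv h z) - cmod (deriv g z)"
        unfolding m_bound_def by (rule cINF_lower[OF _ z])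
      thus ?thesis using less1 r by (smt (verit) mult_left_mono)
    qed
    have m0: "m_bound h g 0 = cmod (deriv h 0) - cmod (deriv g 0)"
      by (simp add: m_bound_def)
    have "0 \<le> \<epsilon> * A" using eps_nonneg A by simp
    \<comment> \<open>An order of value \<open>0\<close> would give \<open>C_bound r = 0\<close>, and no \<open>\<epsilon> \<ge> 0\<close> satisfies the strict bound then.\<close>
    with less2 have "C_bound r \<noteq> 0" by auto
    hence ord: "ord_S_H \<noteq> 0" by (rule C_bound_nonzero_imp_ord_nonzero)
    have sep: "\<epsilon> * A * cmod (w - z) < r * cmod (f w - f z)"
      if wz: "w \<in> cball 0 r" "z \<in> cball 0 r" "w \<noteq> z" for w z
    proof -
      have "\<epsilon> * A * cmod (w - z) < r * (m_bound h g 0 * C_bound r) * cmod (w - z)"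
        using less2 wz(3) by (intro mult_strict_right_mono) auto
      also have "\<dots> = r * (m_bound h g 0 * C_bound r * cmod (w - z))" by simp
      also have "m_bound h g 0 * C_bound r * cmod (w - z) \<le> cmod ((h z + cnj (g z)) - (h w + cnj (g w)))"
        unfolding m0 C_bound_def
        by (rule univalent_pair_two_point_cball[OF second_coeff_bound_ord[OF ord] ord_S_H_ge_half[OF ord] hg r])
           (use wz in auto)
      also have "\<dots> = cmod (f w - f z)"
        using f_rep wz sub by (simp add: harmonic_rep_def norm_minus_commute subset_iff)
      finally show ?thesis using r by simp
    qed
    show ?thesis using jac sep by blast
  qed
  thus ?thesis
    using univalent_sense_preserving_perturbation[OF hg f_rep phi_rep r eps_nonneg A_ge] by blast
qed

end
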